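(* For every connected graph $G$, the connected blocks polytope $\mathrm{CBP}(G)$ is Hirsch.
   Context: Graphs are finite, simple and undirected. A connected graph is 2-connected if it has at least three vertices and remains connected after deleting any single vertex. A bridge is an edge whose deletion increases the number of connected components. A block of $G$ is a maximal 2-connected subgraph of $G$ or a bridge together with its two end vertices; $\mathcal{B}$ denotes the set of blocks of $G$. For $\mathcal{A}\subseteq\mathcal{B}$ let $G[\mathcal{A}]=\bigcup_{B\in\mathcal{A}}B$ (the empty graph counts as connected), and let $\chi^{\mathcal{A}}\in\{0,1\}^{\mathcal{B}}$ be the incidence vector of $\mathcal{A}$. The connected blocks polytope is $\mathrm{CBP}(G)=\mathrm{conv}\{\chi^{\mathcal{A}}\mid \mathcal{A}\subseteq\mathcal{B},\ G[\mathcal{A}]\text{ connected}\}\subseteq\mathbb{R}^{\mathcal{B}}$. A $d$-dimensional polytope with exactly $k$ facets is Hirsch if its diameter is at most $k-d$, where the diameter is the maximum, over all pairs of vertices, of the length of a shortest path between them along edges of the polytope. *)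

theory Defs
  imports "HOL-Analysis.Analysis" "HOL-Library.Extended_Nat"
begin

section \<open>Finite simple graphs\<close>

text \<open>
  A graph is a pair of a vertex set and a set of two-element edges. The vertex set is an arbitrary
  subset of a finite type, so that the subgraphs of a graph live in the same finite type and can
  serve as coordinate indices.
\<close>

type_synonym 'v ugraph = "'v set \<times> 'v set set"

abbreviation verts :: "'v ugraph \<Rightarrow> 'v set" where
  "verts \<equiv> fst"

abbreviation edges :: "'v ugraph \<Rightarrow> 'v set set" where
  "edges \<equiv> snd"

definition is_graph :: "'v ugraph \<Rightarrow> bool" where
  "is_graph G \<longleftrightarrow> (\<forall>e \<in> edges G. e \<subseteq> verts G \<and> card e = 2)"

definition subgraph :: "'v ugraph \<Rightarrow> 'v ugraph \<Rightarrow> bool" where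
  "subgraph H G \<longleftrightarrow> is_graph H \<and> verts H \<subseteq> verts G \<and> edges H \<subseteq> edges G"

definition reachability :: "'v ugraph \<Rightarrow> 'v rel" where
  "reachability G = {(u, v). u \<in> verts G \<and> v \<in> verts G \<and> (u, v) \<in> {(x, y). {x, y} \<in> edges G}\<^sup>*}"

text \<open>The graph without vertices is connected under this definition.\<close>

definition graph_connected :: "'v ugraph \<Rightarrow> bool" where
  "graph_connected G \<longleftrightarrow> (\<forall>u \<in> verts G. \<forall>v \<in> verts G. (u, v) \<in> reachability G)"

definition graph_components :: "'v ugraph \<Rightarrow> 'v set set" where
  "graph_components G = verts G // reachability G"

definition delete_vertex :: "'v ugraph \<Rightarrow> 'v \<Rightarrow> 'v ugraph" where
  "delete_vertex G v = (verts G - {v}, {e \<in> edges G. v \<notin> e})"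

definition delete_edge :: "'v ugraph \<Rightarrow> 'v set \<Rightarrow> 'v ugraph" where
  "delete_edge G e = (verts G, edges G - {e})"


section \<open>Blocks\<close>

definition two_connected :: "'v ugraph \<Rightarrow> bool" where
  "two_connected G \<longleftrightarrow>
     graph_connected G \<and> card (verts G) \<ge> 3 \<and>
     (\<forall>v \<in> verts G. graph_connected (delete_vertex G v))"

definition bridge :: "'v ugraph \<Rightarrow> 'v set \<Rightarrow> bool" where
  "bridge G e \<longleftrightarrow> e \<in> edges G \<and> card (graph_components (delete_edge G e)) > card (graph_components G)"

definition maximal_two_connected_subgraph :: "'v ugraph \<Rightarrow> 'v ugraph \<Rightarrow> bool" where
  "maximal_two_connected_subgraph H G \<longleftrightarrow>
     subgraph H G \<and> two_connected H \<and>
     (\<forall>K. subgraph K G \<and> two_connected K \<and> subgraph H K \<longrightarrow> K = H)"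

text \<open>
  An edge is the set of its end vertices, so a bridge \<open>e\<close> together with its ends is \<open>(e, {e})\<close>.
\<close>

definition blocks :: "'v ugraph \<Rightarrow> 'v ugraph set" where
  "blocks G = {H. maximal_two_connected_subgraph H G} \<union> {(e, {e}) | e. bridge G e}"

definition graph_Union :: "'v ugraph set \<Rightarrow> 'v ugraph" where
  "graph_Union A = (\<Union>B \<in> A. verts B, \<Union>B \<in> A. edges B)"


section \<open>The connected blocks polytope\<close>

text \<open>
  The space \<open>\<real>\<^sup>\<B>\<close> indexed by the blocks of \<open>G\<close> is realised as the coordinate subspace of
  \<open>real ^ 'v ugraph\<close> in which all coordinates not belonging to a block of \<open>G\<close> vanish. Dimension,
  faces, facets and edges of a polytope do not depend on the ambient space, and the case
  \<open>\<B> = {}\<close>, for which there is no index type, is covered too.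
\<close>

definition incidence_vector :: "('v::finite) ugraph set \<Rightarrow> real ^ ('v ugraph)" where
  "incidence_vector A = (\<chi> B. if B \<in> A then 1 else 0)"

definition CBP :: "('v::finite) ugraph \<Rightarrow> (real ^ ('v ugraph)) set" where
  "CBP G = convex hull {incidence_vector A | A. A \<subseteq> blocks G \<and> graph_connected (graph_Union A)}"


section \<open>Hirsch polytopes\<close>

definition polytope_adj :: "('n::euclidean_space) set \<Rightarrow> 'n rel" where
  "polytope_adj P =
     {(u, v). u extreme_point_of P \<and> v extreme_point_of P \<and> closed_segment u v edge_of P}"

text \<open>
  Distances are extended natural numbers, so that vertices not joined by any path would be at
  distance \<open>\<infinity>\<close>.
\<close>

definition polytope_dist :: "('n::euclidean_space) set \<Rightarrow> 'n \<Rightarrow> 'n \<Rightarrow> enat" where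
  "polytope_dist P u v = (INF n \<in> {n. (u, v) \<in> polytope_adj P ^^ n}. enat n)"

definition polytope_diameter :: "('n::euclidean_space) set \<Rightarrow> enat" where
  "polytope_diameter P =
     (SUP (u, v) \<in> {u. u extreme_point_of P} \<times> {v. v extreme_point_of P}. polytope_dist P u v)"

text \<open>The difference \<open>k - d\<close> is taken in the integers, hence is not truncated.\<close>

definition hirsch :: "('n::euclidean_space) set \<Rightarrow> bool" where
  "hirsch P \<longleftrightarrow> polytope P \<and>
     (\<exists>D. polytope_diameter P = enat D \<and> int D \<le> int (card {F. F facet_of P}) - aff_dim P)"

end

theory Submission
  imports Defs
begin

text \<open>
  Like every polytope whose vertices are 0/1-vectors, \<open>CBP G\<close> satisfies the Hirsch bound by an
  argument of Naddef. First, two vertices \<open>u\<close>, \<open>v\<close> of a \<open>d\<close>-dimensional 0/1-polytope are at distance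
  at most \<open>d\<close>: if they agree in a coordinate that is not constant, both lie in a proper face;
  otherwise any neighbour of \<open>u\<close> differs from \<open>u\<close> in some coordinate, hence agrees there with \<open>v\<close>,
  and the two lie in a proper face. Let \<open>k\<close> be the number of facets. If \<open>k \<ge> 2 * d\<close>, then
  \<open>d \<le> k - d\<close>. If \<open>k < 2 * d\<close>, then \<open>u\<close> and \<open>v\<close> lie in a common facet, because every vertex lies in at
  least \<open>d\<close> facets. This facet has dimension \<open>d - 1\<close> and at most \<open>k - 1\<close> facets itself, and one
  concludes by induction.
\<close>

section \<open>Facets and edges of polytopes\<close>

text \<open>A proper face of a polyhedron is the intersection of the facets containing it, so some
  facet \<open>H\<close> containing \<open>G\<close> does not contain \<open>F\<close>. Then
  \<open>F \<inter> H\<close> is a proper face of \<open>F\<close> containing \<open>G\<close>, and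
  codimension one leaves no room between \<open>G\<close> and \<open>F\<close>.\<close>

lemma facet_of_facet:
  fixes P :: "'a::euclidean_space set"
  assumes P: "polyhedron P" and F: "F facet_of P" and G: "G facet_of F"
  obtains H where "H facet_of P" "H \<noteq> F" "G = F \<inter> H"
proof -
  have GF: "G face_of F" and FP: "F face_of P"
    using F G by (auto simp: facet_of_def)
  then have GP: "G face_of P"
    by (rule face_of_trans)
  have dims: "aff_dim G = aff_dim F - 1" "aff_dim F = aff_dim P - 1" "G \<noteq> {}"
    using F G by (auto simp: facet_of_def)
  then have "G \<noteq> P" by auto
  then have eq: "G = \<Inter>{H. H facet_of P \<and> G \<subseteq> H}"
    using face_of_polyhedron[OF P GP] dims by blast
  obtain H where H: "H facet_of P" "G \<subseteq> H" "\<not> F \<subseteq> H"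
  proof (rule ccontr)
    assume "\<not> thesis"
    then have "F \<subseteq> G" using eq that by blast
    then have "F = G" using face_of_imp_subset[OF GF] by blast
    then show False using dims by simp
  qed
  have FH: "F \<inter> H face_of F"
    using H FP by (metis face_of_Int face_of_face facet_of_imp_face_of inf_le1)
  have "aff_dim (F \<inter> H) < aff_dim F"
    using face_of_aff_dim_lt[OF face_of_imp_convex[OF FP] FH] H by blast
  moreover have "G face_of F \<inter> H"
    using GF FH H face_of_face face_of_imp_subset by (metis Int_greatest)
  ultimately have "G = F \<inter> H"
    using face_of_aff_dim_lt[OF face_of_imp_convex[OF FH]] dims by force
  then show thesis using that H by blast
qed

text \<open>The choice of \<open>\<phi> G\<close> is injective because \<open>G\<close> is recovered
  as \<open>F \<inter> \<phi> G\<close>. That the image avoids \<open>F\<close> makes the facet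
  counts below gain one.\<close>

lemma facet_of_facet_injection:
  fixes P :: "'a::euclidean_space set"
  assumes "polyhedron P" and "F facet_of P"
  obtains \<phi> where "inj_on \<phi> {G. G facet_of F}"
    "\<And>G. G facet_of F \<Longrightarrow> \<phi> G facet_of P \<and> \<phi> G \<noteq> F \<and> G = F \<inter> \<phi> G"
proof -
  have "\<forall>G. \<exists>H. G facet_of F \<longrightarrow> H facet_of P \<and> H \<noteq> F \<and> G = F \<inter> H"
    using facet_of_facet[OF assms] by metis
  then obtain \<phi> where \<phi>: "\<And>G. G facet_of F \<Longrightarrow> \<phi> G facet_of P \<and> \<phi> G \<noteq> F \<and> G = F \<inter> \<phi> G"
    by metis
  moreover have "inj_on \<phi> {G. G facet_of F}"
    by (rule inj_onI) (metis \<phi> mem_Collect_eq)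
  ultimately show thesis using that by blast
qed

lemma card_facets_of_facet:
  fixes P :: "'a::euclidean_space set"
  assumes P: "polyhedron P" and F: "F facet_of P"
  shows "card {G. G facet_of F} < card {H. H facet_of P}"
proof -
  obtain \<phi> where \<phi>: "inj_on \<phi> {G. G facet_of F}"
      "\<And>G. G facet_of F \<Longrightarrow> \<phi> G facet_of P \<and> \<phi> G \<noteq> F \<and> G = F \<inter> \<phi> G"
    using facet_of_facet_injection[OF assms] by blast
  have fin: "finite {H. H facet_of P}"
    using P by (rule finite_polyhedron_facets)
  have "\<phi> ` {G. G facet_of F} \<subseteq> {H. H facet_of P} - {F}"
    using \<phi>(2) by blast
  then have "card {G. G facet_of F} \<le> card ({H. H facet_of P} - {F})"
    using card_inj_on_le[OF \<phi>(1)] fin by blast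
  also have "\<dots> < card {H. H facet_of P}"
    using F fin by (intro psubset_card_mono) auto
  finally show ?thesis .
qed

lemma extreme_point_in_facet:
  fixes P :: "'a::euclidean_space set"
  assumes P: "polyhedron P" and u: "u extreme_point_of P" and d: "aff_dim P \<ge> 1"
  obtains F where "F facet_of P" "u extreme_point_of F"
proof -
  have "{u} face_of P" using u by (simp add: face_of_singleton)
  moreover have "{u} \<noteq> P" using d by auto
  ultimately obtain F where "F facet_of P" "{u} \<subseteq> F"
    using face_of_polyhedron_subset_facet[OF P] by blast
  then show thesis
    using that u extreme_point_of_face facet_of_imp_face_of by blast
qed

text \<open>Induction through a facet \<open>F\<close> at \<open>u\<close>: since
  \<open>G \<subseteq> \<phi> G\<close>, the facets of \<open>F\<close> at \<open>u\<close> inject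
  into the facets of \<open>P\<close> at \<open>u\<close> other than \<open>F\<close>, and
  \<open>F\<close> itself adds one.\<close>

lemma aff_dim_le_card_facets_at_extreme_point:
  fixes P :: "'a::euclidean_space set"
  assumes "polyhedron P" and "u extreme_point_of P"
  shows "aff_dim P \<le> int (card {F. F facet_of P \<and> u \<in> F})"
  using assms
proof (induction "nat (aff_dim P)" arbitrary: P rule: less_induct)
  case less
  show ?case
  proof (cases "aff_dim P \<ge> 1")
    case True
    obtain F where F: "F facet_of P" "u extreme_point_of F"
      using extreme_point_in_facet[OF less.prems True] by blast
    have dF: "aff_dim F = aff_dim P - 1" using F by (simp add: facet_of_def)
    have "polyhedron F"
      using F(1) face_of_polyhedron_polyhedron facet_of_imp_face_of less.prems(1) by blast
    then have IH: "aff_dim F \<le> int (card {G. G facet_of F \<and> u \<in> G})"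
      using less.hyps[of F] F dF True by simp
    obtain \<phi> where \<phi>: "inj_on \<phi> {G. G facet_of F}"
        "\<And>G. G facet_of F \<Longrightarrow> \<phi> G facet_of P \<and> \<phi> G \<noteq> F \<and> G = F \<inter> \<phi> G"
      using facet_of_facet_injection[OF less.prems(1) F(1)] by blast
    have fin: "finite {H. H facet_of P \<and> u \<in> H}"
      using finite_polyhedron_facets[OF less.prems(1)] by (rule rev_finite_subset) blast
    have "\<phi> ` {G. G facet_of F \<and> u \<in> G} \<subseteq> {H. H facet_of P \<and> u \<in> H} - {F}"
      using \<phi>(2) by blast
    moreover have "inj_on \<phi> {G. G facet_of F \<and> u \<in> G}"
      using \<phi>(1) by (rule inj_on_subset) blast
    ultimately have "card {G. G facet_of F \<and> u \<in> G} \<le> card ({H. H facet_of P \<and> u \<in> H} - {F})"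
      using card_inj_on_le fin by blast
    also have "\<dots> < card {H. H facet_of P \<and> u \<in> H}"
      using F fin by (intro psubset_card_mono) (auto simp: extreme_point_of_def)
    finally show ?thesis using IH dF by linarith
  next
    case False
    have "u \<in> P" using less.prems(2) by (simp add: extreme_point_of_def)
    then show ?thesis using False by linarith
  qed
qed

lemma polytope_adj_face_of:
  assumes "F face_of P"
  shows "polytope_adj F \<subseteq> polytope_adj P"
  using assms face_of_trans
  by (auto simp: polytope_adj_def edge_of_def extreme_point_of_face)

text \<open>Faces of a face are faces, so the inductions on dimension can lift a path from a face to
  \<open>P\<close> at the same length.\<close>

lemma polytope_adj_relpow_face_of:
  "F face_of P \<Longrightarrow> (u, v) \<in> polytope_adj F ^^ n \<Longrightarrow> (u, v) \<in> polytope_adj P ^^ n"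
  by (induction n arbitrary: v) (use polytope_adj_face_of in \<open>fastforce+\<close>)

text \<open>Descending through facets at \<open>u\<close> ends at a segment with \<open>u\<close> as
  an endpoint; this segment is an edge of every polytope passed on the way.\<close>

lemma polytope_adj_exists:
  fixes P :: "'a::euclidean_space set"
  assumes "polytope P" and "u extreme_point_of P" and "aff_dim P \<ge> 1"
  obtains w where "(u, w) \<in> polytope_adj P" "w \<noteq> u"
proof -
  have "\<exists>w. (u, w) \<in> polytope_adj P \<and> w \<noteq> u"
    using assms
  proof (induction "nat (aff_dim P)" arbitrary: P rule: less_induct)
    case less
    note P = polytope_imp_polyhedron[OF less.prems(1)]
    show ?case
    proof (cases "aff_dim P = 1")
      case True
      have "convex P" "compact P" "P \<noteq> {}"
        using less.prems polytope_imp_convex polytope_imp_compact by auto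
      then obtain a b where ab: "P = closed_segment a b"
        using True collinear_aff_dim[of P] compact_convex_collinear_segment by (metis order_refl)
      have "a \<noteq> b" using True ab by auto
      have "P edge_of P" using True \<open>convex P\<close> by (simp add: edge_of_def face_of_refl)
      then have "(a, b) \<in> polytope_adj P" "(b, a) \<in> polytope_adj P"
        using ab by (auto simp: polytope_adj_def extreme_point_of_segment closed_segment_commute)
      moreover have "u = a \<or> u = b"
        using less.prems(2) ab by (simp add: extreme_point_of_segment)
      ultimately show ?thesis using \<open>a \<noteq> b\<close> by blast
    next
      case False
      obtain F where F: "F facet_of P" "u extreme_point_of F"
        using extreme_point_in_facet[OF P less.prems(2,3)] by blast
      have FP: "F face_of P" and dF: "aff_dim F = aff_dim P - 1"
        using F by (auto simp: facet_of_def)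
      obtain w where "(u, w) \<in> polytope_adj F" "w \<noteq> u"
        using less.hyps[of F] F dF False less.prems face_of_polytope_polytope[OF _ FP] by auto
      then show ?thesis using polytope_adj_face_of[OF FP] by blast
    qed
  qed
  then show thesis using that by blast
qed


section \<open>Polytopes with 0/1-vertices\<close>

text \<open>Constraining only the extreme points, in the coordinates of the ambient space, makes the
  property pass to faces unchanged.\<close>

definition zero_one :: "'a::euclidean_space set \<Rightarrow> bool" where
  "zero_one P \<longleftrightarrow> (\<forall>x b. x extreme_point_of P \<longrightarrow> b \<in> Basis \<longrightarrow> b \<bullet> x \<in> {0, 1})"

lemma zero_one_face_of: "zero_one P \<Longrightarrow> F face_of P \<Longrightarrow> zero_one F"
  by (simp add: zero_one_def extreme_point_of_face)

lemma zero_one_coordinate_face: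
  fixes P :: "'a::euclidean_space set"
  assumes P: "polytope P" and 01: "zero_one P" and u: "u extreme_point_of P" and b: "b \<in> Basis"
  shows "P \<inter> {x. b \<bullet> x = b \<bullet> u} face_of P"
proof -
  \<comment> \<open>The bounds 0 and 1 carry over from the extreme points to all of
    \<open>P\<close>, so fixing the coordinate at either value cuts out a face by a supporting
    hyperplane.\<close>
  have "P = convex hull {x. x extreme_point_of P}"
    using P by (intro Krein_Milman_Minkowski) (auto intro: polytope_imp_compact polytope_imp_convex)
  moreover have "convex hull {x. x extreme_point_of P} \<subseteq> {x. b \<bullet> x \<ge> 0} \<inter> {x. b \<bullet> x \<le> 1}"
    using 01 b
    by (intro hull_minimal convex_Int convex_halfspace_le convex_halfspace_ge)
      (force simp: zero_one_def)
  ultimately have "b \<bullet> x \<ge> 0 \<and> b \<bullet> x \<le> 1" if "x \<in> P" for x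
    using that by blast
  moreover have "b \<bullet> u = 0 \<or> b \<bullet> u = 1"
    using 01 u b by (simp add: zero_one_def)
  ultimately show ?thesis
    using face_of_Int_supporting_hyperplane_ge[of P 0 b]
      face_of_Int_supporting_hyperplane_le[of P b 1] polytope_imp_convex[OF P] by auto
qed

lemma zero_one_path_le_aff_dim:
  fixes P :: "'a::euclidean_space set"
  assumes "polytope P" "zero_one P" "u extreme_point_of P" "v extreme_point_of P"
  shows "\<exists>n. (u, v) \<in> polytope_adj P ^^ n \<and> int n \<le> aff_dim P"
  using assms
proof (induction "nat (aff_dim P)" arbitrary: P u v rule: less_induct)
  case less
  note P = less.prems(1) and 01 = less.prems(2) and u = less.prems(3) and v = less.prems(4)
  have uvP: "u \<in> P" "v \<in> P"
    using u v by (auto simp: extreme_point_of_def)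
  have dP: "aff_dim P \<ge> 0"
    using uvP(1) aff_dim_subset[of "{u}" P] by simp
  \<comment> \<open>The induction hypothesis in the form used twice below: \<open>x\<close> and
    \<open>y\<close> share the coordinate \<open>b\<close>, and \<open>z\<close> witnesses that the
    face fixing it is proper.\<close>
  have IH: "\<exists>n. (x, y) \<in> polytope_adj P ^^ n \<and> int n \<le> aff_dim P - 1"
    if xy: "x extreme_point_of P" "y extreme_point_of P" and z: "z \<in> P"
      and b: "b \<in> Basis" "b \<bullet> x = b \<bullet> y" "b \<bullet> z \<noteq> b \<bullet> x" for x y z b
  proof -
    define F where "F = P \<inter> {p. b \<bullet> p = b \<bullet> x}"
    have F: "F face_of P"
      unfolding F_def by (rule zero_one_coordinate_face[OF P 01 xy(1) b(1)])
    have xyF: "x extreme_point_of F" "y extreme_point_of F"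
      using xy b F by (auto simp: extreme_point_of_face) (auto simp: F_def extreme_point_of_def)
    then have "x \<in> F" by (simp add: extreme_point_of_def)
    \<comment> \<open>The measure \<open>nat (aff_dim P)\<close> does not separate dimensions -1 and
      0, so a strict decrease needs \<open>F\<close> to be nonempty.\<close>
    then have dF: "aff_dim F \<ge> 0"
      using aff_dim_subset[of "{x}" F] by simp
    have "F \<noteq> P" using z b by (auto simp: F_def)
    then have lt: "aff_dim F < aff_dim P"
      using face_of_aff_dim_lt[OF polytope_imp_convex[OF P] F] by blast
    obtain n where "(x, y) \<in> polytope_adj F ^^ n" "int n \<le> aff_dim F"
      using less.hyps[OF _ face_of_polytope_polytope[OF P F] zero_one_face_of[OF 01 F] xyF] lt dF
      by auto
    then show ?thesis
      using polytope_adj_relpow_face_of[OF F] lt by force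
  qed
  show ?case
  proof (cases "u = v")
    case True
    then show ?thesis using dP by (intro exI[of _ 0]) auto
  next
    case False
    have "aff_dim {u, v} \<le> aff_dim P"
      using uvP by (intro aff_dim_subset) auto
    then have "aff_dim P \<ge> 1" using False by (simp add: aff_dim_2)
    then obtain w where uw: "(u, w) \<in> polytope_adj P" "w \<noteq> u"
      using polytope_adj_exists[OF P u] by blast
    then have w: "w extreme_point_of P" by (simp add: polytope_adj_def)
    then have wP: "w \<in> P" by (simp add: extreme_point_of_def)
    obtain b where b: "b \<in> Basis" "b \<bullet> w \<noteq> b \<bullet> u"
      using uw(2) by (metis euclidean_eqI inner_commute)
    show ?thesis
    proof (cases "b \<bullet> u = b \<bullet> v")
      case True
      then show ?thesis using IH[OF u v wP b(1)] b(2) by force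
    next
      case False
      \<comment> \<open>Only two values are possible, and both \<open>w\<close> and \<open>v\<close>
        differ from \<open>u\<close> at \<open>b\<close>. Hence \<open>u\<close> is the witness that
        the face shared by \<open>w\<close> and \<open>v\<close> is proper.\<close>
      then have "b \<bullet> w = b \<bullet> v"
        using b 01 u v w unfolding zero_one_def by (metis insert_iff singletonD)
      then obtain n where n: "(w, v) \<in> polytope_adj P ^^ n" "int n \<le> aff_dim P - 1"
        using IH[OF w v uvP(1) b(1)] b(2) by force
      then have "(u, v) \<in> polytope_adj P ^^ Suc n"
        using uw(1) by (meson relpow_Suc_I2)
      then show ?thesis using n(2) by (intro exI[of _ "Suc n"]) simp
    qed
  qed
qed

lemma zero_one_path_le_facets_minus_aff_dim:
  fixes P :: "'a::euclidean_space set"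
  assumes "polytope P" "zero_one P" "u extreme_point_of P" "v extreme_point_of P"
  shows "\<exists>n. (u, v) \<in> polytope_adj P ^^ n \<and> int n \<le> int (card {F. F facet_of P}) - aff_dim P"
  using assms
proof (induction "nat (aff_dim P)" arbitrary: P rule: less_induct)
  case less
  note P = less.prems(1) and 01 = less.prems(2) and u = less.prems(3) and v = less.prems(4)
  note poly = polytope_imp_polyhedron[OF P]
  show ?case
  proof (cases "int (card {F. F facet_of P}) \<ge> 2 * aff_dim P")
    case True
    then show ?thesis using zero_one_path_le_aff_dim[OF less.prems] by fastforce
  next
    case False
    let ?A = "\<lambda>x. {F. F facet_of P \<and> x \<in> F}"
    have fin: "finite {F. F facet_of P}"
      using poly by (rule finite_polyhedron_facets)
    then have finA: "finite (?A x)" for x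
      by (rule rev_finite_subset) blast
    have "?A u \<inter> ?A v \<noteq> {}"
    proof
      assume "?A u \<inter> ?A v = {}"
      then have "card (?A u) + card (?A v) = card (?A u \<union> ?A v)"
        by (intro card_Un_disjoint[symmetric] finA)
      also have "\<dots> \<le> card {F. F facet_of P}"
        by (intro card_mono fin) blast
      finally show False
        using False aff_dim_le_card_facets_at_extreme_point[OF poly u]
          aff_dim_le_card_facets_at_extreme_point[OF poly v] by linarith
    qed
    then obtain F where F: "F facet_of P" "u \<in> F" "v \<in> F" by blast
    have FP: "F face_of P" and dF: "aff_dim F = aff_dim P - 1"
      using F by (auto simp: facet_of_def)
    have ext: "u extreme_point_of F" "v extreme_point_of F"
      using F u v by (auto simp: extreme_point_of_face[OF FP])
    have "aff_dim F \<ge> 0"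
      using F(2) aff_dim_subset[of "{u}" F] by simp
    then obtain n where n: "(u, v) \<in> polytope_adj F ^^ n"
        "int n \<le> int (card {G. G facet_of F}) - aff_dim F"
      using less.hyps[OF _ face_of_polytope_polytope[OF P FP] zero_one_face_of[OF 01 FP] ext] dF
      by auto
    \<comment> \<open>From \<open>P\<close> to \<open>F\<close> the dimension drops by exactly one
      and the facet count by at least one, so the bound for \<open>F\<close> is at most the bound
      for \<open>P\<close>.\<close>
    then show ?thesis
      using polytope_adj_relpow_face_of[OF FP] card_facets_of_facet[OF poly F(1)] dF by force
  qed
qed

theorem zero_one_polytope_hirsch:
  fixes P :: "'a::euclidean_space set"
  assumes P: "polytope P" and 01: "zero_one P"
  shows "hirsch P"
proof -
  define k where "k = int (card {F. F facet_of P}) - aff_dim P"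
  have dist: "polytope_dist P u v \<le> enat (nat k)"
    if uv: "u extreme_point_of P" "v extreme_point_of P" for u v
  proof -
    obtain n where n: "(u, v) \<in> polytope_adj P ^^ n" "int n \<le> k"
      using zero_one_path_le_facets_minus_aff_dim[OF P 01 uv] unfolding k_def by blast
    have "polytope_dist P u v \<le> enat n"
      unfolding polytope_dist_def using n(1) by (intro INF_lower) simp
    also have "\<dots> \<le> enat (nat k)" using n(2) by simp
    finally show ?thesis .
  qed
  \<comment> \<open>Ensures that \<open>nat k\<close> does not truncate. The empty polytope has
    dimension -1; otherwise the length of a path from a vertex to itself is a lower bound for
    \<open>k\<close>.\<close>
  have "k \<ge> 0"
  proof (cases "P = {}")
    case True
    then show ?thesis by (simp add: k_def)
  next
    case False
    then obtain u where u: "u extreme_point_of P"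
      using extreme_point_exists_convex[OF polytope_imp_compact[OF P] polytope_imp_convex[OF P]]
      by blast
    then show ?thesis
      using zero_one_path_le_facets_minus_aff_dim[OF P 01 u u] unfolding k_def by force
  qed
  have le: "polytope_diameter P \<le> enat (nat k)"
    unfolding polytope_diameter_def using dist by (auto intro!: SUP_least)
  then obtain D where D: "polytope_diameter P = enat D"
    by (metis enat_ile)
  then have "int D \<le> k" using le \<open>k \<ge> 0\<close> by simp
  then show ?thesis
    using P D unfolding hirsch_def k_def by blast
qed


section \<open>The connected blocks polytope\<close>

theorem corollary6p4:
  fixes G :: "('v::finite) ugraph"
  assumes "is_graph G" and "graph_connected G"
  shows "hirsch (CBP G)"
proof (rule zero_one_polytope_hirsch)
  let ?S = "{incidence_vector A | A. A \<subseteq> blocks G \<and> graph_connected (graph_Union A)}"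
  have "finite (range (incidence_vector :: 'v ugraph set \<Rightarrow> _))"
    by simp
  then have "finite ?S"
    by (rule rev_finite_subset) blast
  then show "polytope (CBP G)"
    unfolding CBP_def by (rule polytope_convex_hull)
  \<comment> \<open>Basis vectors are axis vectors, so the inner product reads off one entry.
    Extreme points of a convex hull are among its generators, which here are incidence
    vectors.\<close>
  have "b \<bullet> incidence_vector A \<in> {0, 1}" if "b \<in> Basis" for b and A :: "'v ugraph set"
    using that by (auto simp: Basis_vec_def inner_axis' incidence_vector_def)
  then show "zero_one (CBP G)"
    unfolding CBP_def zero_one_def using extreme_point_of_convex_hull by blast
qed

end
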